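(* Let $K$ be an algebraically closed field, $1\le d\le n-1$, $X\le K^n$ a linear subspace of dimension $d+1$ with Plücker coordinates $q=(q_I)_{I\in\binom{[n]}{d+1}}$, and $S\subseteq[n]$. Suppose there is $C\in\binom{[n]}{d+1}$ with $S\subseteq C$ and $q_C\ne0$. Then $L^S(X)$ is a linear projective variety of dimension at most $d$, cut out by the $S$-incidence relations $I^S_{A,B}$, $A\in\binom{[n]}{d-1}$, $B\in\binom{[n]}{d+2}$; i.e. $L^S(X)$ equals (the projectivization of) the kernel of the matrix $U^S$.
   Context: $\mathrm{Gr}(d,n)\subseteq\mathbb{P}^{\binom{n}{d}-1}$ is the Grassmannian in its Plücker embedding, with homogeneous coordinates $P_J$, $J\in\binom{[n]}{d}$. $\mathrm{pr}_S:K^n\to K^n$ kills $e_i$ for $i\in S$ and fixes $e_i$ for $i\notin S$; $L^S(X)=\{Y\in\mathrm{Gr}(d,n):\mathrm{pr}_S(Y)\subseteq X\}$. The $S$-incidence relation is the linear form $$I^S_{A,B}=\sum_{i\in B\setminus(A\cup S)}(-1)^{|[i]\cap A|+|[i]\cap B|}q_{B\setminus i}\,P_{A\cup i}.$$ $U^S$ is the $\binom{n}{d-1}\binom{n}{d+2}\times\binom{n}{d}$ matrix whose row indexed by $(A,B)$ is the coefficient vector of $I^S_{A,B}$: $U^S_{(A,B),J}=(-1)^{|[i]\cap A|+|[i]\cap B|}q_{B\setminus i}$ if $J=A\cup i$ with $i\in B\setminus(A\cup S)$, and $0$ otherwise. *)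

theory Defs
  imports
    "HOL-Analysis.Analysis"
    "HOL-Computational_Algebra.Computational_Algebra"
    "Jordan_Normal_Form.Determinant"
begin

no_notation Matrix.vec_index (infixl \<open>$\<close> 100)

text \<open>
  The ordered index set \<open>[n]\<close> is a finite linearly ordered type \<open>'n\<close>, so \<open>K\<^sup>n\<close> is \<open>'k ^ 'n\<close>
  and \<open>[i]\<close> is \<open>{..i}\<close>.  The space with coordinates indexed by the \<open>d\<close>-element subsets of
  \<open>[n]\<close> is the subspace \<open>pluecker_space d\<close> of \<open>'k ^ 'n set\<close> of vectors whose other coordinates
  vanish.
\<close>

definition pluecker_space :: "nat \<Rightarrow> ('k::field ^ ('n::finite set)) set" where
  "pluecker_space d = {P. \<forall>J. card J \<noteq> d \<longrightarrow> P $ J = 0}"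

text \<open>Points of projective space are the lines through the origin.\<close>

definition projectivization :: "('k::field ^ 'm::finite) set \<Rightarrow> ('k ^ 'm) set set" where
  "projectivization W = {vec.span {P} | P. P \<in> W \<and> P \<noteq> 0}"

definition linear_projective_variety ::
    "('k::field ^ 'm::finite) set \<Rightarrow> nat \<Rightarrow> ('k ^ 'm) set set \<Rightarrow> bool" where
  "linear_projective_variety V m L \<longleftrightarrow>
     (\<exists>W. vec.subspace W \<and> W \<subseteq> V \<and> vec.dim W = m + 1 \<and> L = projectivization W)"

definition grassmannian :: "nat \<Rightarrow> ('k::field ^ 'n::finite) set set" where
  "grassmannian d = {Y. vec.subspace Y \<and> vec.dim Y = d}"

text \<open>The minor, in the columns \<open>J\<close>, of the matrix whose rows are the vectors in \<open>bs\<close>.\<close>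

definition minor :: "('k::field ^ 'n::{finite,linorder}) list \<Rightarrow> 'n set \<Rightarrow> 'k" where
  "minor bs J =
     Determinant.det (Matrix.mat (length bs) (length bs)
       (\<lambda>(r, c). (bs ! r) $ (sorted_list_of_set J ! c)))"

text \<open>
  Homogeneous coordinates depend on the choice of a basis, so this is a relation:
  \<open>P\<close> is the vector of maximal minors of some basis of \<open>Y\<close>.
\<close>

definition pluecker_coords ::
    "nat \<Rightarrow> ('k::field ^ 'n::{finite,linorder}) set \<Rightarrow> 'k ^ 'n set \<Rightarrow> bool" where
  "pluecker_coords d Y P \<longleftrightarrow>
     (\<exists>bs. length bs = d \<and> distinct bs \<and> vec.independent (set bs) \<and> vec.span (set bs) = Y \<and>
        P = (\<chi> J. if card J = d then minor bs J else 0))"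

definition pr :: "'n set \<Rightarrow> 'k::field ^ 'n::finite \<Rightarrow> 'k ^ 'n" where
  "pr S v = (\<chi> i. if i \<in> S then 0 else v $ i)"

definition L_variety ::
    "nat \<Rightarrow> 'n set \<Rightarrow> ('k::field ^ 'n::{finite,linorder}) set \<Rightarrow> ('k ^ 'n set) set set" where
  "L_variety d S X =
     {vec.span {P} | P Y. Y \<in> grassmannian d \<and> pr S ` Y \<subseteq> X \<and> pluecker_coords d Y P}"

definition incidence ::
    "'n set \<Rightarrow> 'k::field ^ 'n set \<Rightarrow> 'n set \<Rightarrow> 'n set \<Rightarrow> 'k ^ 'n::{finite,linorder} set \<Rightarrow> 'k" where
  "incidence S q A B P =
     (\<Sum>i\<in>B - (A \<union> S). (-1) ^ (card ({..i} \<inter> A) + card ({..i} \<inter> B)) * q $ (B - {i}) * P $ (insert i A))"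

definition incidence_locus ::
    "nat \<Rightarrow> 'n set \<Rightarrow> 'k::field ^ 'n::{finite,linorder} set \<Rightarrow> ('k ^ 'n set) set set" where
  "incidence_locus d S q =
     {vec.span {P} | P. P \<in> pluecker_space d \<and> P \<noteq> 0 \<and>
        (\<forall>A B. card A = d - 1 \<longrightarrow> card B = d + 2 \<longrightarrow> incidence S q A B P = 0)}"

text \<open>
  Rows that are not indexed by a pair in \<open>([n] choose d - 1) \<times> ([n] choose d + 2)\<close> are zero.
  The sum has at most one term, since \<open>J = insert i A\<close> with \<open>i \<notin> A\<close> determines \<open>i\<close>.
\<close>

definition U_matrix ::
    "nat \<Rightarrow> 'n set \<Rightarrow> 'k::field ^ 'n::{finite,linorder} set \<Rightarrow> 'k ^ 'n set ^ ('n set \<times> 'n set)" where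
  "U_matrix d S q =
     (\<chi> AB. \<chi> J. case AB of (A, B) \<Rightarrow>
        if card A = d - 1 \<and> card B = d + 2
        then \<Sum>i | i \<in> B - (A \<union> S) \<and> J = insert i A.
               (-1) ^ (card ({..i} \<inter> A) + card ({..i} \<inter> B)) * q $ (B - {i})
        else 0)"

text \<open>
  The columns of \<open>U_matrix d S q\<close> at \<open>J\<close> with \<open>card J \<noteq> d\<close> are zero padding, so the kernel is
  taken inside \<open>pluecker_space d\<close>.
\<close>

definition U_kernel ::
    "nat \<Rightarrow> 'n set \<Rightarrow> 'k::field ^ 'n::{finite,linorder} set \<Rightarrow> ('k ^ 'n set) set" where
  "U_kernel d S q = {P \<in> pluecker_space d. U_matrix d S q *v P = 0}"

end

theory Submission
  imports Defs
begin

text \<open>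
  Write \<open>Z\<close> for the space of all \<open>v\<close> with \<open>pr S v \<in> X\<close>, so that \<open>L_variety d S X\<close> consists of
  the Pluecker points of the \<open>d\<close>-dimensional subspaces of \<open>Z\<close>.  Since \<open>q $ C \<noteq> 0\<close>, the space \<open>X\<close>
  has a basis \<open>x\<close> that restricts to the standard basis on the coordinates in \<open>C\<close>.  As \<open>S \<subseteq> C\<close>,
  the vectors \<open>x c\<close> with \<open>c \<in> C - S\<close> are fixed by \<open>pr S\<close>; together with the unit vectors at the
  places in \<open>S\<close>, which \<open>pr S\<close> kills, they form a basis of the same shape of \<open>Z\<close>
  (lemma \<open>coordinate_basis_pr_vimage\<close>).  Hence \<open>Z\<close> has dimension \<open>d + 1\<close>, and the variety is the
  space of hyperplanes of \<open>Z\<close>, that is, the projectivization of the \<open>d\<close>-th exterior power of \<open>Z\<close>.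

  To see this power inside the ambient coordinate space without exterior algebra, a vector \<open>P\<close> of
  Pluecker type is contracted by a \<open>(d - 1)\<close>-set \<open>A\<close>, which gives the vector \<open>contraction P A\<close> of
  \<open>K\<^sup>n\<close> with entries \<open>\<plusminus> P $ insert i A\<close>.  The exterior power of \<open>Z\<close> is characterized as
  \<open>contraction_space d Z\<close>, the set of those \<open>P\<close> all of whose contractions lie in \<open>Z\<close>.  Two facts
  carry the proof.

  \<^item> The linear forms \<open>v \<mapsto> (\<Sum>i\<in>B. \<plusminus> q $ (B - {i}) * v $ i)\<close> cut out \<open>X\<close> (lemma
    \<open>incidence_forms_cut_out\<close>), and the incidence relation of \<open>A\<close> and \<open>B\<close> evaluates the form of \<open>B\<close>
    at the vector \<open>pr S (contraction P A)\<close>.  So the incidence relations say exactly that all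
    contractions of \<open>P\<close> lie in \<open>Z\<close>: the kernel of the matrix is \<open>contraction_space d Z\<close>.

  \<^item> An element of \<open>contraction_space d Z\<close> is determined by its \<open>d + 1\<close> entries at the sets
    \<open>C - {c}\<close> (lemma \<open>contraction_space_eq_0\<close>).  Given \<open>P \<noteq> 0\<close> in this space, scaled to have entry
    \<open>1\<close> at some \<open>D = C - {c0}\<close>, the contractions of \<open>P\<close> by the sets \<open>D - {c}\<close> span a
    \<open>d\<close>-dimensional subspace of \<open>Z\<close> whose Pluecker vector has the same \<open>d + 1\<close> entries, and so is
    equal to \<open>P\<close> (lemma \<open>contraction_space_decomposable\<close>).

  The determinants enter only through Laplace expansion: along a column it shows that the
  contractions of the Pluecker vector of \<open>Y\<close> lie in \<open>Y\<close>, along a row that the incidence forms vanish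
  on \<open>X\<close>.
\<close>

no_notation fps_nth (infixl "$" 75)

section \<open>Laplace expansion of minors\<close>

text \<open>
  Listing the columns instead of sorting a set of them allows repeated columns and makes the
  position of a column explicit.
\<close>

definition column_minor :: "('k::field ^ 'n::finite) list \<Rightarrow> 'n list \<Rightarrow> 'k" where
  "column_minor bs js =
     Determinant.det (Matrix.mat (length bs) (length bs) (\<lambda>(r, c). (bs ! r) $ (js ! c)))"

definition drop_nth :: "nat \<Rightarrow> 'a list \<Rightarrow> 'a list" where
  "drop_nth r xs = take r xs @ drop (Suc r) xs"

lemma length_drop_nth: "r < length xs \<Longrightarrow> length (drop_nth r xs) = length xs - 1"
  by (simp add: drop_nth_def)

lemma nth_drop_nth:
  "r < length xs \<Longrightarrow> m < length xs - 1 \<Longrightarrow>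
     drop_nth r xs ! m = xs ! (if m < r then m else Suc m)"
  by (auto simp: drop_nth_def nth_append min_def)

lemma minor_eq_column_minor: "minor bs J = column_minor bs (sorted_list_of_set J)"
  by (simp add: minor_def column_minor_def)

lemma mat_delete_selection:
  assumes "length js = length bs" "r < length bs" "c < length bs"
  shows "Determinant.det (mat_delete
      (Matrix.mat (length bs) (length bs) (\<lambda>(r, c). (bs ! r) $ (js ! c))) r c) =
    column_minor (drop_nth r bs) (drop_nth c js)"
  unfolding column_minor_def mat_delete_def
  using assms
  by (intro arg_cong[where f = Determinant.det] eq_matI)
    (auto simp: length_drop_nth nth_drop_nth)

lemma column_minor_expand_column:
  assumes "length js = length bs" "c < length bs"
  shows "column_minor bs js =
    (-1) ^ c * (\<Sum>r<length bs. (-1) ^ r * column_minor (drop_nth r bs) (drop_nth c js) * bs ! r $ (js ! c))"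
proof -
  have "column_minor bs js = (\<Sum>r<length bs. bs ! r $ (js ! c) *
      ((-1) ^ (r + c) * column_minor (drop_nth r bs) (drop_nth c js)))"
    unfolding column_minor_def[of bs js]
    using assms
    by (subst laplace_expansion_column[where j = c and n = "length bs"])
      (auto simp: cofactor_def mat_delete_selection)
  thus ?thesis
    by (simp add: sum_distrib_left power_add algebra_simps)
qed

lemma column_minor_expand_row:
  assumes "length js = length bs" "r < length bs"
  shows "column_minor bs js =
    (-1) ^ r * (\<Sum>c<length bs. (-1) ^ c * column_minor (drop_nth r bs) (drop_nth c js) * bs ! r $ (js ! c))"
proof -
  have "column_minor bs js = (\<Sum>c<length bs. bs ! r $ (js ! c) *
      ((-1) ^ (r + c) * column_minor (drop_nth r bs) (drop_nth c js)))"
    unfolding column_minor_def[of bs js]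
    using assms
    by (subst laplace_expansion_row[where i = r and n = "length bs"])
      (auto simp: cofactor_def mat_delete_selection)
  thus ?thesis
    by (simp add: sum_distrib_left power_add algebra_simps)
qed

text \<open>
  The exponent \<open>card ({..i} \<inter> A)\<close> of the signs in the incidence relations is the position of \<open>i\<close> in
  the sorted list of \<open>insert i A\<close>.
\<close>

lemma sorted_list_of_set_insert_split:
  fixes A :: "'n::{finite,linorder} set"
  assumes "i \<notin> A"
  obtains L1 L2 where "sorted_list_of_set A = L1 @ L2"
    "sorted_list_of_set (insert i A) = L1 @ i # L2" "length L1 = card ({..i} \<inter> A)"
proof
  let ?L1 = "sorted_list_of_set {a \<in> A. a < i}" and ?L2 = "sorted_list_of_set {a \<in> A. i < a}"
  have less: "x < i \<or> i < x" if "x \<in> A" for x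
    using that assms by (metis antisym_conv3)
  have eqI: "sorted_list_of_set B = xs" if "sorted_wrt (<) xs" "set xs = B" for xs and B :: "'n set"
    using that(1) unfolding that(2)[symmetric]
    by (simp add: sorted_list_of_set.idem_if_sorted_distinct strict_sorted_iff)
  show "sorted_list_of_set A = ?L1 @ ?L2"
    by (rule eqI) (use less in \<open>auto simp: sorted_wrt_append\<close>)
  show "sorted_list_of_set (insert i A) = ?L1 @ i # ?L2"
    by (rule eqI) (use less in \<open>auto simp: sorted_wrt_append\<close>)
  have "{..i} \<inter> A = {a \<in> A. a < i}"
    using assms by (auto simp: le_less)
  thus "length ?L1 = card ({..i} \<inter> A)" by simp
qed

section \<open>Pluecker vectors, contractions and incidence forms\<close>

text \<open>
  Up to a global sign, this is the interior product of the alternating tensor \<open>P\<close> with the coordinate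
  forms indexed by \<open>A\<close>.
\<close>

definition contraction :: "'k::field ^ 'n set \<Rightarrow> 'n set \<Rightarrow> 'k ^ 'n::{finite,linorder}" where
  "contraction P A =
     (\<chi> i. if i \<in> A then 0 else (-1) ^ card ({..i} \<inter> A) * P $ insert i A)"

definition pluecker_vector :: "('k::field ^ 'n::{finite,linorder}) list \<Rightarrow> 'k ^ 'n set" where
  "pluecker_vector bs = (\<chi> J. if card J = length bs then minor bs J else 0)"

definition incidence_form ::
    "'k::field ^ 'n set \<Rightarrow> 'n set \<Rightarrow> 'k ^ 'n::{finite,linorder} \<Rightarrow> 'k" where
  "incidence_form q B v = (\<Sum>i\<in>B. (-1) ^ card ({..i} \<inter> B) * q $ (B - {i}) * v $ i)"

text \<open>
  The entry at \<open>i\<close> of the contraction is the minor with column \<open>i\<close> put in front of the columns in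
  \<open>A\<close>; it vanishes for \<open>i \<in> A\<close> because a column is repeated.  Expanding along the first column shows
  that the contraction is a combination of the rows with coefficients independent of \<open>i\<close>.
\<close>

lemma contraction_pluecker_vector:
  fixes bs :: "('k::field ^ 'n::{finite,linorder}) list"
  assumes A: "Suc (card A) = length bs"
  shows "contraction (pluecker_vector bs) A =
    (\<Sum>r<length bs. ((-1) ^ r * minor (drop_nth r bs) A) *s bs ! r)"
proof (subst Finite_Cartesian_Product.vec_eq_iff, intro allI)
  fix i
  show "contraction (pluecker_vector bs) A $ i =
    (\<Sum>r<length bs. ((-1) ^ r * minor (drop_nth r bs) A) *s bs ! r) $ i"
  proof (cases "i \<in> A")
    case False
    obtain L1 L2 where L: "sorted_list_of_set A = L1 @ L2"
      "sorted_list_of_set (insert i A) = L1 @ i # L2" "length L1 = card ({..i} \<inter> A)"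
      using sorted_list_of_set_insert_split[OF False] .
    have "length (sorted_list_of_set (insert i A)) = length bs"
      using False A by simp
    hence len: "length (L1 @ i # L2) = length bs"
      using L(2) by simp
    have "minor bs (insert i A) = column_minor bs (L1 @ i # L2)"
      by (simp add: minor_eq_column_minor L)
    also have "\<dots> = (-1) ^ length L1 *
        (\<Sum>r<length bs. (-1) ^ r * column_minor (drop_nth r bs) (L1 @ L2) * bs ! r $ i)"
      using len by (subst column_minor_expand_column[where c = "length L1"])
        (auto simp: drop_nth_def)
    finally show ?thesis
      using False A
      by (simp add: contraction_def pluecker_vector_def L minor_eq_column_minor
          flip: mult.assoc power_add mult_2)
  next
    case True
    let ?js = "i # sorted_list_of_set A"
    \<comment> \<open>The zero entry is the expansion of a minor in which column \<open>i\<close> occurs twice.\<close>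
    obtain c where c: "c < card A" "sorted_list_of_set A ! c = i"
      using True by (metis finite in_set_conv_nth length_sorted_list_of_set set_sorted_list_of_set)
    have pos: "0 < length bs" using A by linarith
    have "column_minor bs ?js = 0"
      unfolding column_minor_def
      by (rule det_identical_columns[where n = "length bs" and i = 0 and j = "Suc c"])
        (use A c pos in \<open>auto intro!: eq_vecI\<close>)
    moreover have "column_minor bs ?js =
        (\<Sum>r<length bs. (-1) ^ r * column_minor (drop_nth r bs) (sorted_list_of_set A) * bs ! r $ i)"
      using A by (subst column_minor_expand_column[where c = 0]) (auto simp: drop_nth_def)
    ultimately show ?thesis
      using True by (simp add: contraction_def minor_eq_column_minor)
  qed
qed

lemma contraction_pluecker_vector_in_span:
  assumes "Suc (card A) = length bs"
  shows "contraction (pluecker_vector bs) A \<in> vec.span (set bs)"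
  unfolding contraction_pluecker_vector[OF assms]
  by (intro vec.span_sum vec.span_scale vec.span_base) simp

text \<open>
  By induction, the rows after the first one have a nonzero minor, in columns \<open>A\<close> say.  If all
  maximal minors vanished, so would the contraction by \<open>A\<close>, which is a combination of the rows in
  which the first row has this nonzero minor as its coefficient.
\<close>

lemma independent_imp_minor_nonzero:
  fixes bs :: "('k::field ^ 'n::{finite,linorder}) list"
  assumes "distinct bs" "vec.independent (set bs)"
  shows "\<exists>J. card J = length bs \<and> minor bs J \<noteq> 0"
  using assms
proof (induction bs)
  case Nil
  have "minor [] ({} :: 'n set) = (1 :: 'k)"
    by (simp add: minor_def)
  thus ?case by (metis card.empty list.size(3) zero_neq_one)
next
  case (Cons b bs)
  have b: "b \<notin> vec.span (set bs)" and ind: "vec.independent (set bs)"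
    using Cons.prems by (auto simp: vec.independent_insert)
  then obtain A where A: "card A = length bs" "minor bs A \<noteq> 0"
    using Cons by auto
  show ?case
  proof (rule ccontr)
    assume "\<nexists>J. card J = length (b # bs) \<and> minor (b # bs) J \<noteq> 0"
    hence "pluecker_vector (b # bs) = 0"
      by (auto simp: pluecker_vector_def Finite_Cartesian_Product.vec_eq_iff)
    hence "0 = contraction (pluecker_vector (b # bs)) A"
      by (simp add: contraction_def Finite_Cartesian_Product.vec_eq_iff)
    also have "\<dots> = minor bs A *s b +
        (\<Sum>r<length bs. ((-1) ^ Suc r * minor (drop_nth (Suc r) (b # bs)) A) *s bs ! r)"
      using A by (subst contraction_pluecker_vector)
        (simp_all add: sum.lessThan_Suc_shift drop_nth_def del: sum.lessThan_Suc)
    finally have "minor bs A *s b =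
        - (\<Sum>r<length bs. ((-1) ^ Suc r * minor (drop_nth (Suc r) (b # bs)) A) *s bs ! r)"
      by (simp add: eq_neg_iff_add_eq_0)
    hence "minor bs A *s b \<in> vec.span (set bs)"
      by (simp only:) (intro vec.span_neg vec.span_sum vec.span_scale vec.span_base, simp)
    hence "inverse (minor bs A) *s (minor bs A *s b) \<in> vec.span (set bs)"
      by (rule vec.span_scale)
    thus False using A b by simp
  qed
qed

lemma drop_nth_sorted_list_of_set:
  fixes B :: "'n::{finite,linorder} set"
  assumes "c < card B" and i: "i = sorted_list_of_set B ! c"
  shows "drop_nth c (sorted_list_of_set B) = sorted_list_of_set (B - {i})"
    and "card ({..i} \<inter> B) = Suc c"
proof -
  have iB: "i \<in> B"
    using assms by (metis finite length_sorted_list_of_set nth_mem set_sorted_list_of_set)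
  obtain L1 L2 where L: "sorted_list_of_set (B - {i}) = L1 @ L2"
      "sorted_list_of_set (insert i (B - {i})) = L1 @ i # L2"
      "length L1 = card ({..i} \<inter> (B - {i}))"
    using sorted_list_of_set_insert_split[of i "B - {i}"] by auto
  have B: "sorted_list_of_set B = L1 @ i # L2"
    using L(2) iB by (simp add: insert_absorb)
  have "distinct (L1 @ i # L2)" "length (L1 @ i # L2) = card B"
    unfolding B[symmetric] by auto
  moreover have "(L1 @ i # L2) ! c = (L1 @ i # L2) ! length L1"
    using i B by simp
  ultimately have c: "c = length L1"
    using assms(1) by (subst (asm) nth_eq_iff_index_eq) auto
  show "drop_nth c (sorted_list_of_set B) = sorted_list_of_set (B - {i})"
    by (simp add: B L(1) c drop_nth_def)
  have "{..i} \<inter> B = insert i ({..i} \<inter> (B - {i}))"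
    using iB by auto
  thus "card ({..i} \<inter> B) = Suc c"
    by (simp add: c L(3))
qed

text \<open>
  The incidence form of \<open>B\<close> is a determinant with first row \<open>v\<close>, expanded along that row.  The
  overall sign comes from counting places from \<open>1\<close> in \<open>card ({..i} \<inter> B)\<close> but from \<open>0\<close> in the
  expansion.
\<close>

lemma incidence_form_eq_minor:
  fixes bs :: "('k::field ^ 'n::{finite,linorder}) list"
  assumes B: "card B = Suc (length bs)"
  shows "incidence_form (pluecker_vector bs) B v = - minor (v # bs) B"
proof -
  let ?js = "sorted_list_of_set B"
  have "minor (v # bs) B =
      (\<Sum>c<card B. (-1) ^ c * column_minor bs (drop_nth c ?js) * v $ (?js ! c))"
    unfolding minor_eq_column_minor
    using B by (subst column_minor_expand_row[where r = 0]) (auto simp: drop_nth_def)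
  also have "\<dots> = (\<Sum>c<card B. - ((-1) ^ card ({..?js ! c} \<inter> B) *
      pluecker_vector bs $ (B - {?js ! c}) * v $ (?js ! c)))"
  proof (rule sum.cong[OF refl])
    fix c assume "c \<in> {..<card B}"
    hence c: "c < card B" by simp
    have "?js ! c \<in> B"
      using c by (metis finite length_sorted_list_of_set nth_mem set_sorted_list_of_set)
    thus "(-1) ^ c * column_minor bs (drop_nth c ?js) * v $ (?js ! c) =
      - ((-1) ^ card ({..?js ! c} \<inter> B) * pluecker_vector bs $ (B - {?js ! c}) * v $ (?js ! c))"
      using B drop_nth_sorted_list_of_set[OF c refl]
      by (simp add: pluecker_vector_def minor_eq_column_minor)
  qed
  also have "\<dots> = (\<Sum>i\<in>B. - ((-1) ^ card ({..i} \<inter> B) * pluecker_vector bs $ (B - {i}) * v $ i))"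
    by (rule sum.reindex_bij_betw[where h = "\<lambda>c. ?js ! c"]) (auto intro!: bij_betw_nth)
  finally show ?thesis
    by (simp add: incidence_form_def sum_negf)
qed

lemma subspace_incidence_form: "vec.subspace {v. incidence_form q B v = 0}"
  by (intro vec.subspaceI)
    (auto simp: incidence_form_def algebra_simps sum.distrib simp flip: sum_distrib_left)

lemma incidence_form_eq_0:
  fixes bs :: "('k::field ^ 'n::{finite,linorder}) list"
  assumes "card B = Suc (length bs)" and v: "v \<in> vec.span (set bs)"
  shows "incidence_form (pluecker_vector bs) B v = 0"
proof -
  have "incidence_form (pluecker_vector bs) B b = 0" if b: "b \<in> set bs" for b
  proof -
    obtain r where r: "r < length bs" "bs ! r = b"
      using b by (auto simp: in_set_conv_nth)
    have "minor (b # bs) B = 0"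
      unfolding minor_def
      by (rule det_identical_rows[where n = "Suc (length bs)" and i = 0 and j = "Suc r"])
        (use r in \<open>auto intro!: eq_vecI\<close>)
    thus ?thesis using incidence_form_eq_minor[OF assms(1)] by simp
  qed
  hence "vec.span (set bs) \<subseteq> {v. incidence_form (pluecker_vector bs) B v = 0}"
    by (intro vec.span_minimal subspace_incidence_form) auto
  thus ?thesis using v by auto
qed

text \<open>
  On vectors supported outside \<open>C\<close>, the form of \<open>insert j C\<close> is \<open>\<plusminus> q $ C\<close> times the coordinate at \<open>j\<close>.
\<close>

lemma incidence_forms_separate:
  fixes q :: "'k::field ^ 'n::{finite,linorder} set"
  assumes q: "q $ C \<noteq> 0"
    and v: "\<And>B. card B = Suc (card C) \<Longrightarrow> incidence_form q B v = 0"
    and vC: "\<And>c. c \<in> C \<Longrightarrow> v $ c = 0"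
  shows "v = 0"
proof -
  have "v $ j = 0" for j
  proof (cases "j \<in> C")
    case False
    have "incidence_form q (insert j C) v =
        (-1) ^ card ({..j} \<inter> insert j C) * q $ (insert j C - {j}) * v $ j"
      unfolding incidence_form_def using False vC by (subst sum.insert) auto
    moreover have "incidence_form q (insert j C) v = 0"
      using False by (intro v) simp
    ultimately show ?thesis using q False by simp
  qed (use vC in auto)
  thus ?thesis by (simp add: Finite_Cartesian_Product.vec_eq_iff)
qed

section \<open>Bases dual to a set of coordinates\<close>

text \<open>
  The subspace \<open>Z\<close> is the graph of a linear map from the coordinates in \<open>C\<close> to the other ones, and
  \<open>z\<close> is the basis of \<open>Z\<close> lying over the standard basis.  The notion is used for subspaces of \<open>K\<^sup>n\<close>
  and also for a subspace of the space of Pluecker coordinates.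
\<close>

definition coordinate_basis ::
    "'m set \<Rightarrow> ('m \<Rightarrow> 'k::field ^ 'm) \<Rightarrow> ('k ^ 'm) set \<Rightarrow> bool" where
  "coordinate_basis C z Z \<longleftrightarrow> vec.subspace Z \<and>
     (\<forall>c\<in>C. z c \<in> Z \<and> (\<forall>c'\<in>C. z c $ c' = of_bool (c = c'))) \<and>
     (\<forall>v\<in>Z. (\<forall>c\<in>C. v $ c = 0) \<longrightarrow> v = 0)"

lemma coordinate_basisD:
  assumes "coordinate_basis C z Z"
  shows "vec.subspace Z" "\<And>c. c \<in> C \<Longrightarrow> z c \<in> Z"
    "\<And>c c'. c \<in> C \<Longrightarrow> c' \<in> C \<Longrightarrow> z c $ c' = of_bool (c = c')"
    "\<And>v. v \<in> Z \<Longrightarrow> (\<And>c. c \<in> C \<Longrightarrow> v $ c = 0) \<Longrightarrow> v = 0"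
  using assms unfolding coordinate_basis_def by blast+

lemma coordinate_basis_expand:
  assumes "coordinate_basis C z Z" "v \<in> Z"
  shows "v = (\<Sum>c\<in>C. v $ c *s z c)"
proof -
  note Z = coordinate_basisD[OF assms(1)]
  have "v - (\<Sum>c\<in>C. v $ c *s z c) = 0"
  proof (rule Z(4))
    show "v - (\<Sum>c\<in>C. v $ c *s z c) \<in> Z"
      using assms(2) Z(1,2) by (intro vec.subspace_diff vec.subspace_sum vec.subspace_scale) auto
    fix c assume "c \<in> C"
    thus "(v - (\<Sum>c\<in>C. v $ c *s z c)) $ c = 0"
      by (simp add: Z(3) of_bool_def if_distrib cong: if_cong)
  qed
  thus ?thesis by simp
qed

lemma coordinate_basis_span_image:
  fixes z :: "'m \<Rightarrow> 'k::field ^ 'm"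
  assumes z: "\<And>c c'. c \<in> C \<Longrightarrow> c' \<in> C \<Longrightarrow> z c $ c' = of_bool (c = c')"
  shows "coordinate_basis C z (vec.span (z ` C))"
proof -
  have "vec.span (z ` C) \<subseteq> {v. v = (\<Sum>c\<in>C. v $ c *s z c)}"
  proof (intro vec.span_minimal vec.subspaceI)
    show "z ` C \<subseteq> {v. v = (\<Sum>c\<in>C. v $ c *s z c)}"
    proof clarsimp
      fix c assume c: "c \<in> C"
      have "(\<Sum>c'\<in>C. z c $ c' *s z c') = (\<Sum>c'\<in>C. if c = c' then z c' else 0)"
        by (rule sum.cong) (auto simp: z c)
      thus "z c = (\<Sum>c'\<in>C. z c $ c' *s z c')"
        using c by simp
    qed
  next
    fix u v :: "'k ^ 'm"
    assume "u \<in> {v. v = (\<Sum>c\<in>C. v $ c *s z c)}" "v \<in> {v. v = (\<Sum>c\<in>C. v $ c *s z c)}"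
    hence uv: "(\<Sum>c\<in>C. u $ c *s z c) = u" "(\<Sum>c\<in>C. v $ c *s z c) = v" by auto
    have "(\<Sum>c\<in>C. (u + v) $ c *s z c) = (\<Sum>c\<in>C. u $ c *s z c) + (\<Sum>c\<in>C. v $ c *s z c)"
      by (simp add: vec.scale_left_distrib sum.distrib)
    also have "\<dots> = u + v" unfolding uv ..
    finally show "u + v \<in> {v. v = (\<Sum>c\<in>C. v $ c *s z c)}" by simp
  next
    fix a :: 'k and v :: "'k ^ 'm"
    assume "v \<in> {v. v = (\<Sum>c\<in>C. v $ c *s z c)}"
    hence v: "(\<Sum>c\<in>C. v $ c *s z c) = v" by auto
    have "(\<Sum>c\<in>C. (a *s v) $ c *s z c) = a *s (\<Sum>c\<in>C. v $ c *s z c)"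
      by (simp add: vec.scale_sum_right)
    also have "\<dots> = a *s v" unfolding v ..
    finally show "a *s v \<in> {v. v = (\<Sum>c\<in>C. v $ c *s z c)}" by simp
  qed simp
  hence "v = (\<Sum>c\<in>C. v $ c *s z c)" if "v \<in> vec.span (z ` C)" for v
    using that by blast
  moreover have "(\<Sum>c\<in>C. v $ c *s z c) = 0" if "\<And>c. c \<in> C \<Longrightarrow> v $ c = 0" for v :: "'k ^ 'm"
    using that by simp
  ultimately have zero: "v = 0" if "v \<in> vec.span (z ` C)" "\<And>c. c \<in> C \<Longrightarrow> v $ c = 0" for v
    using that by metis
  show ?thesis
    unfolding coordinate_basis_def
  proof (intro conjI ballI impI vec.subspace_span)
    fix c assume "c \<in> C"
    thus "z c \<in> vec.span (z ` C)" by (intro vec.span_base imageI)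
  next
    fix c c' assume "c \<in> C" "c' \<in> C"
    thus "z c $ c' = of_bool (c = c')" by (rule z)
  next
    fix v assume "v \<in> vec.span (z ` C)" "\<forall>c\<in>C. v $ c = 0"
    thus "v = 0" by (intro zero) blast+
  qed
qed

lemma coordinate_basis_independent:
  assumes "coordinate_basis C z Z"
  shows "inj_on z C" "vec.independent (z ` C)" "vec.span (z ` C) = Z" "vec.dim Z = card C"
proof -
  note Z = coordinate_basisD[OF assms]
  show inj: "inj_on z C"
  proof (rule inj_onI)
    fix c c' assume c: "c \<in> C" "c' \<in> C" and "z c = z c'"
    hence "z c $ c = z c' $ c" by (simp only:)
    thus "c = c'" unfolding Z(3)[OF c(1) c(1)] Z(3)[OF c(2) c(1)] by (cases "c = c'") auto
  qed
  show ind: "vec.independent (z ` C)"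
  proof (rule vec.independent_if_scalars_zero)
    fix f x assume "(\<Sum>x\<in>z ` C. f x *s x) = 0" "x \<in> z ` C"
    then obtain c where c: "c \<in> C" "x = z c" and "(\<Sum>c\<in>C. f (z c) *s z c) = 0"
      using inj by (auto simp: sum.reindex)
    hence "(\<Sum>c'\<in>C. f (z c') *s z c') $ c = 0" by simp
    thus "f x = 0"
      using c by (simp add: Z(3) of_bool_def if_distrib cong: if_cong)
  qed simp
  show "vec.span (z ` C) = Z"
  proof (rule vec.span_subspace[OF _ _ Z(1)])
    show "Z \<subseteq> vec.span (z ` C)"
    proof
      fix v assume "v \<in> Z"
      thus "v \<in> vec.span (z ` C)"
        by (subst coordinate_basis_expand[OF assms])
          (auto intro: vec.span_sum vec.span_scale vec.span_base)
    qed
  qed (use Z(2) in auto)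
  with ind show "vec.dim Z = card C"
    using inj by (metis card_image vec.dim_span_eq_card_independent)
qed

section \<open>Coordinate bases and Pluecker coordinates\<close>

lemma pluecker_coords_iff:
  "pluecker_coords d Y P \<longleftrightarrow>
     (\<exists>bs. length bs = d \<and> distinct bs \<and> vec.independent (set bs) \<and> vec.span (set bs) = Y \<and>
        P = pluecker_vector bs)"
  by (auto simp: pluecker_coords_def pluecker_vector_def)

lemma pluecker_coords_contraction:
  assumes "pluecker_coords d Y P" "Suc (card A) = d"
  shows "contraction P A \<in> Y"
  using assms by (auto simp: pluecker_coords_iff intro!: contraction_pluecker_vector_in_span)

lemma pluecker_coords_nonzero:
  assumes "pluecker_coords d Y P"
  shows "P \<noteq> 0"
proof
  assume "P = 0"
  obtain bs where bs: "length bs = d" "distinct bs" "vec.independent (set bs)" "P = pluecker_vector bs"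
    using assms by (auto simp: pluecker_coords_iff)
  obtain J where "card J = length bs" "minor bs J \<noteq> 0"
    using independent_imp_minor_nonzero[OF bs(2,3)] by auto
  hence "P $ J \<noteq> 0" using bs by (simp add: pluecker_vector_def)
  with \<open>P = 0\<close> show False by simp
qed

lemma pluecker_coords_imp_pluecker_space:
  "pluecker_coords d Y P \<Longrightarrow> P \<in> pluecker_space d"
  by (auto simp: pluecker_coords_def pluecker_space_def)

lemma pluecker_coords_imp_grassmannian:
  assumes "pluecker_coords d Y P"
  shows "Y \<in> grassmannian d"
proof -
  obtain bs where "length bs = d" "distinct bs" "vec.independent (set bs)" "vec.span (set bs) = Y"
    using assms by (auto simp: pluecker_coords_def)
  thus ?thesis
    unfolding grassmannian_def
    using vec.dim_span_eq_card_independent[of "set bs"] distinct_card[of bs]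
    by (auto simp: vec.subspace_span)
qed

text \<open>
  The contractions of \<open>P\<close> by the sets \<open>D - {c}\<close>, normalized so that they are dual to the coordinates
  in \<open>D\<close>: at \<open>c\<close> the contraction has the entry \<open>\<plusminus> P $ D\<close>, and at the other elements of \<open>D\<close> it is
  zero.
\<close>

definition contraction_frame :: "'k::field ^ 'n set \<Rightarrow> 'n set \<Rightarrow> 'n \<Rightarrow> 'k ^ 'n::{finite,linorder}" where
  "contraction_frame P D c =
     ((-1) ^ card ({..c} \<inter> (D - {c})) / P $ D) *s contraction P (D - {c})"

lemma contraction_frame_nth:
  assumes "P $ D \<noteq> 0" "c \<in> D" "c' \<in> D"
  shows "contraction_frame P D c $ c' = of_bool (c = c')"
  using assms
  by (auto simp: contraction_frame_def contraction_def insert_absorb field_simps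
      simp flip: power_add mult_2)

lemma incidence_form_pluecker_coords_eq_0:
  assumes "pluecker_coords (card C) X q" "card B = Suc (card C)" "v \<in> X"
  shows "incidence_form q B v = 0"
  using assms by (auto simp: pluecker_coords_iff intro!: incidence_form_eq_0)

lemma contraction_frame_coordinate_basis:
  assumes q: "pluecker_coords (card C) X q" and qC: "q $ C \<noteq> 0"
  shows "coordinate_basis C (contraction_frame q C) X"
  unfolding coordinate_basis_def
proof (intro conjI ballI impI)
  show X: "vec.subspace X"
    using pluecker_coords_imp_grassmannian[OF q] by (simp add: grassmannian_def)
  fix c assume c: "c \<in> C"
  hence "Suc (card (C - {c})) = card C" by (intro card_Suc_Diff1) simp_all
  thus "contraction_frame q C c \<in> X"
    unfolding contraction_frame_def
    by (intro vec.subspace_scale[OF X] pluecker_coords_contraction[OF q])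
  fix c' assume "c' \<in> C"
  thus "contraction_frame q C c $ c' = of_bool (c = c')"
    using qC c by (intro contraction_frame_nth)
next
  fix v assume v: "v \<in> X" "\<forall>c\<in>C. v $ c = 0"
  show "v = 0"
    by (rule incidence_forms_separate[OF qC incidence_form_pluecker_coords_eq_0[OF q _ v(1)]])
      (use v(2) in auto)
qed

text \<open>
  If all forms vanish at \<open>v\<close>, they also vanish at the difference of \<open>v\<close> and the element of \<open>X\<close> with
  the same coordinates in \<open>C\<close>.  This difference is zero at \<open>C\<close>, hence zero.
\<close>

lemma incidence_forms_cut_out:
  assumes q: "pluecker_coords (card C) X q" and qC: "q $ C \<noteq> 0"
  shows "v \<in> X \<longleftrightarrow> (\<forall>B. card B = Suc (card C) \<longrightarrow> incidence_form q B v = 0)"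
proof
  assume "v \<in> X"
  thus "\<forall>B. card B = Suc (card C) \<longrightarrow> incidence_form q B v = 0"
    using incidence_form_pluecker_coords_eq_0[OF q] by blast
next
  assume v: "\<forall>B. card B = Suc (card C) \<longrightarrow> incidence_form q B v = 0"
  note Z = coordinate_basisD[OF contraction_frame_coordinate_basis[OF q qC]]
  define w where "w = (\<Sum>c\<in>C. v $ c *s contraction_frame q C c)"
  have w: "w \<in> X"
    unfolding w_def using Z(1,2) by (intro vec.subspace_sum vec.subspace_scale) auto
  have "v - w = 0"
  proof (rule incidence_forms_separate[OF qC])
    fix B :: "'b set" assume "card B = Suc (card C)"
    hence "v \<in> {v. incidence_form q B v = 0}" "w \<in> {v. incidence_form q B v = 0}"
      using v incidence_form_pluecker_coords_eq_0[OF q _ w] by auto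
    from vec.subspace_diff[OF subspace_incidence_form this]
    show "incidence_form q B (v - w) = 0" by simp
  next
    fix c assume "c \<in> C"
    thus "(v - w) $ c = 0"
      by (simp add: w_def Z(3) of_bool_def if_distrib cong: if_cong)
  qed
  with w show "v \<in> X" by simp
qed

text \<open>
  For \<open>c \<notin> S\<close> the vector \<open>x c\<close> vanishes at \<open>S \<subseteq> C\<close> and is fixed by \<open>pr S\<close>; the unit vectors at \<open>S\<close>
  are mapped to \<open>0\<close>.
\<close>

lemma coordinate_basis_pr_vimage:
  fixes x :: "'n \<Rightarrow> 'k::field ^ 'n"
  assumes x: "coordinate_basis C x X" and S: "S \<subseteq> C"
  shows "coordinate_basis C (\<lambda>c. if c \<in> S then axis c 1 else x c) {v. pr S v \<in> X}"
  unfolding coordinate_basis_def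
proof (intro conjI ballI impI)
  note X = coordinate_basisD[OF x]
  have nth: "pr S v $ i = (if i \<in> S then 0 else v $ i)" for v :: "'k ^ 'n" and i
    by (simp add: pr_def)
  have add: "pr S (u + v) = pr S u + pr S v" for u v :: "'k ^ 'n"
    by (simp add: Finite_Cartesian_Product.vec_eq_iff nth)
  have scale: "pr S (a *s v) = a *s pr S v" for a and v :: "'k ^ 'n"
    by (simp add: Finite_Cartesian_Product.vec_eq_iff nth)
  have zero: "pr S (0 :: 'k ^ 'n) = 0"
    by (simp add: Finite_Cartesian_Product.vec_eq_iff nth)
  show "vec.subspace {v. pr S v \<in> X}"
    using X(1) by (intro vec.subspaceI)
      (auto simp: add scale zero vec.subspace_0 vec.subspace_add vec.subspace_scale)
  {
    fix c assume c: "c \<in> C"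
    have "pr S (axis c 1 :: 'k ^ 'n) = 0" if "c \<in> S"
      using that by (simp add: Finite_Cartesian_Product.vec_eq_iff nth axis_def)
    moreover have "pr S (x c) = x c" if "c \<notin> S"
    proof -
      have "x c $ s = 0" if "s \<in> S" for s
        using X(3)[OF c, of s] that S \<open>c \<notin> S\<close> by auto
      thus ?thesis by (simp add: Finite_Cartesian_Product.vec_eq_iff nth)
    qed
    ultimately show "(if c \<in> S then axis c 1 else x c) \<in> {v. pr S v \<in> X}"
      using c X(1,2) by (auto simp: vec.subspace_0)
    fix c' assume "c' \<in> C"
    thus "(if c \<in> S then axis c 1 else x c) $ c' = of_bool (c = c')"
      using c X(3) by (auto simp: axis_def)
  }
  fix v assume v: "v \<in> {v. pr S v \<in> X}" "\<forall>c\<in>C. v $ c = 0"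
  hence "pr S v = v" using S by (auto simp: Finite_Cartesian_Product.vec_eq_iff nth)
  thus "v = 0" using v X(4)[of v] by auto
qed

text \<open>In the columns \<open>D\<close> the matrix of a coordinate basis is the identity matrix.\<close>

lemma coordinate_basis_pluecker_coords:
  fixes z :: "'n \<Rightarrow> 'k::field ^ 'n::{finite,linorder}"
  assumes z: "coordinate_basis D z Y"
  shows "\<exists>Q. pluecker_coords (card D) Y Q \<and> Q $ D = 1"
proof -
  note ind = coordinate_basis_independent[OF z]
  let ?L = "sorted_list_of_set D"
  have nth: "?L ! r \<in> D" if "r < card D" for r
    using that by (metis finite length_sorted_list_of_set nth_mem set_sorted_list_of_set)
  have "minor (map z ?L) D = Determinant.det (1\<^sub>m (card D))"
    unfolding minor_def
    by (intro arg_cong[where f = Determinant.det] eq_matI)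
      (auto simp: coordinate_basisD(3)[OF z] nth nth_eq_iff_index_eq)
  hence "pluecker_vector (map z ?L) $ D = 1"
    by (simp add: pluecker_vector_def)
  moreover have "pluecker_coords (card D) Y (pluecker_vector (map z ?L))"
    unfolding pluecker_coords_iff using ind
    by (intro exI[of _ "map z ?L"]) (auto simp: distinct_map)
  ultimately show ?thesis by blast
qed

section \<open>The space of tensors with all contractions in a subspace\<close>

text \<open>
  If \<open>Z\<close> has a coordinate basis indexed by \<open>d + 1\<close> places, this is the \<open>d\<close>-th exterior power of
  \<open>Z\<close>, in coordinates.
\<close>

definition contraction_space ::
    "nat \<Rightarrow> ('k::field ^ 'n::{finite,linorder}) set \<Rightarrow> ('k ^ 'n set) set" where
  "contraction_space d Z =
     {P \<in> pluecker_space d. \<forall>A. card A = d - 1 \<longrightarrow> contraction P A \<in> Z}"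

lemma contraction_add: "contraction (P + Q) A = contraction P A + contraction Q A"
  and contraction_scale: "contraction (a *s P) A = a *s contraction P A"
  and contraction_0: "contraction 0 A = 0"
  by (simp_all add: contraction_def Finite_Cartesian_Product.vec_eq_iff algebra_simps)

lemma subspace_contraction_space:
  assumes "vec.subspace Z"
  shows "vec.subspace (contraction_space d Z)"
  using assms
  by (intro vec.subspaceI)
    (auto simp: contraction_space_def pluecker_space_def contraction_add contraction_scale
      contraction_0 vec.subspace_0 vec.subspace_add vec.subspace_scale)

lemma pluecker_coords_in_contraction_space:
  assumes "pluecker_coords d Y P" "Y \<subseteq> Z" "1 \<le> d"
  shows "P \<in> contraction_space d Z"
proof -
  have "contraction P A \<in> Z" if "card A = d - 1" for A
    using pluecker_coords_contraction[OF assms(1), of A] assms that by auto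
  thus ?thesis
    using pluecker_coords_imp_pluecker_space[OF assms(1)] by (simp add: contraction_space_def)
qed

text \<open>
  Induction on the number of elements of \<open>J\<close> outside \<open>C\<close> shows that the entry at \<open>J\<close> is zero.  If
  \<open>j\<close> is such an element, the contraction by \<open>J - {j}\<close> lies in \<open>Z\<close>, and its coordinates at \<open>C\<close> are
  entries of \<open>P\<close> at sets with fewer elements outside \<open>C\<close>.  They vanish, so the contraction is zero,
  and its coordinate at \<open>j\<close> is the entry of \<open>P\<close> at \<open>J\<close> up to sign.
\<close>

lemma contraction_space_eq_0:
  fixes P :: "'k::field ^ 'n::{finite,linorder} set"
  assumes z: "coordinate_basis C z Z" and C: "card C = Suc d" and d: "1 \<le> d"
    and P: "P \<in> contraction_space d Z" and PC: "\<And>c. c \<in> C \<Longrightarrow> P $ (C - {c}) = 0"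
  shows "P = 0"
proof -
  have "P $ J = 0" if J: "card J = d" for J
    using J
  proof (induction "card (J - C)" arbitrary: J rule: less_induct)
    case less
    show ?case
    proof (cases "J \<subseteq> C")
      case True
      have "card (C - J) = 1"
        using True C less.prems by (simp add: card_Diff_subset)
      then obtain c where "C - J = {c}" by (auto simp: card_1_singleton_iff)
      hence "c \<in> C" "J = C - {c}" using True by auto
      thus ?thesis using PC by simp
    next
      case False
      then obtain j where j: "j \<in> J" "j \<notin> C" by auto
      let ?A = "J - {j}"
      have "contraction P ?A = 0"
      proof (rule coordinate_basisD(4)[OF z])
        show "contraction P ?A \<in> Z"
          using P j less.prems by (simp add: contraction_space_def)
        fix c assume c: "c \<in> C"
        show "contraction P ?A $ c = 0"
        proof (cases "c \<in> ?A")
          case False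
          have "J - C = insert j (insert c ?A - C)"
            using j c by auto
          hence "card (J - C) = Suc (card (insert c ?A - C))"
            using j c by simp
          moreover have "card (insert c ?A) = d"
            using False j less.prems d by (simp add: card_Diff_singleton)
          ultimately have "P $ insert c ?A = 0"
            by (intro less.hyps) simp_all
          thus ?thesis by (simp add: contraction_def)
        qed (simp add: contraction_def)
      qed
      hence "contraction P ?A $ j = 0" by simp
      thus ?thesis using j by (simp add: contraction_def insert_absorb)
    qed
  qed
  moreover have "P $ J = 0" if "card J \<noteq> d" for J
    using P that by (simp add: contraction_space_def pluecker_space_def)
  ultimately have "P $ J = 0" for J by blast
  thus ?thesis by (simp add: Finite_Cartesian_Product.vec_eq_iff)
qed

text \<open>
  After scaling to \<open>R\<close> with entry \<open>1\<close> at \<open>D = C - {c0}\<close>, let \<open>Y\<close> be the span of the contractions of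
  \<open>R\<close> by the sets \<open>D - {c}\<close>, and \<open>Q\<close> its Pluecker vector with entry \<open>1\<close> at \<open>D\<close>.  By the previous
  lemma it suffices to compare \<open>R\<close> and \<open>Q\<close> at the sets \<open>C - {c}\<close>.  The contractions of both by
  \<open>D - {c}\<close> lie in \<open>Y\<close> and have the same coordinates in \<open>D\<close>, so they are equal, and their
  coordinates at \<open>c0\<close> are, with the same sign, the entries of \<open>R\<close> and \<open>Q\<close> at \<open>C - {c}\<close>.  No minor
  besides the one at \<open>D\<close> has to be computed.
\<close>

lemma contraction_space_decomposable:
  fixes P :: "'k::field ^ 'n::{finite,linorder} set"
  assumes z: "coordinate_basis C z Z" and C: "card C = Suc d" and d: "1 \<le> d"
    and P: "P \<in> contraction_space d Z" and P0: "P \<noteq> 0"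
  shows "\<exists>Y a. a \<noteq> 0 \<and> Y \<subseteq> Z \<and> pluecker_coords d Y (a *s P)"
proof -
  note Z = coordinate_basisD[OF z]
  obtain c0 where c0: "c0 \<in> C" "P $ (C - {c0}) \<noteq> 0"
    using contraction_space_eq_0[OF z C d P] P0 by blast
  let ?D = "C - {c0}"
  define a where "a = 1 / P $ ?D"
  define R where "R = a *s P"
  have a: "a \<noteq> 0" and RD: "R $ ?D = 1"
    using c0 by (simp_all add: a_def R_def)
  have R: "R \<in> contraction_space d Z"
    unfolding R_def by (intro vec.subspace_scale subspace_contraction_space Z(1) P)
  let ?y = "contraction_frame R ?D"
  let ?Y = "vec.span (?y ` ?D)"
  have card_D: "card ?D = d" using C c0 by simp
  have y: "coordinate_basis ?D ?y ?Y"
    using RD by (intro coordinate_basis_span_image contraction_frame_nth) auto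
  note Y = coordinate_basisD[OF y]
  have "?y c \<in> Z" if "c \<in> ?D" for c
    unfolding contraction_frame_def
    using that R card_D
    by (intro vec.subspace_scale Z(1)) (simp add: contraction_space_def)
  hence YZ: "?Y \<subseteq> Z"
    by (intro vec.span_minimal Z(1)) auto
  obtain Q where Q: "pluecker_coords d ?Y Q" "Q $ ?D = 1"
    using coordinate_basis_pluecker_coords[OF y] card_D by auto
  have "R - Q = 0"
  proof (rule contraction_space_eq_0[OF z C d])
    show "R - Q \<in> contraction_space d Z"
      using R pluecker_coords_in_contraction_space[OF Q(1) YZ d]
      by (intro vec.subspace_diff subspace_contraction_space Z(1))
    fix c assume c: "c \<in> C"
    show "(R - Q) $ (C - {c}) = 0"
    proof (cases "c = c0")
      case False
      hence cD: "c \<in> ?D" using c by auto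
      let ?A = "?D - {c}"
      have "contraction R ?A = (-1) ^ card ({..c} \<inter> ?A) *s ?y c"
        unfolding contraction_frame_def RD by (simp flip: power_add mult_2)
      hence RY: "contraction R ?A \<in> ?Y"
        using Y(2)[OF cD] by (simp add: vec.span_scale)
      have QY: "contraction Q ?A \<in> ?Y"
        using cD card_D d by (intro pluecker_coords_contraction[OF Q(1)]) simp
      have "contraction R ?A - contraction Q ?A = 0"
      proof (rule Y(4))
        show "contraction R ?A - contraction Q ?A \<in> ?Y"
          using RY QY by (rule vec.span_diff)
        fix c' assume "c' \<in> ?D"
        thus "(contraction R ?A - contraction Q ?A) $ c' = 0"
          using RD Q(2) cD by (cases "c' = c") (auto simp: contraction_def insert_absorb)
      qed
      hence "contraction R ?A $ c0 = contraction Q ?A $ c0" by simp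
      moreover have "insert c0 ?A = C - {c}" using False c0 by auto
      ultimately show ?thesis using False by (simp add: contraction_def)
    qed (use RD Q in simp)
  qed
  hence "Q = a *s P" by (simp add: R_def)
  with a YZ Q show ?thesis by blast
qed

text \<open>
  The basis vector at \<open>C - {c}\<close> is the Pluecker vector of the span \<open>Y\<close> of all \<open>z c'\<close> with \<open>c' \<noteq> c\<close>.
  Its other entries of this kind vanish: they are coordinates at \<open>c\<close> of contractions, which lie in
  \<open>Y\<close>, and every element of \<open>Y\<close> is zero at \<open>c\<close>.
\<close>

lemma contraction_space_coordinate_basis:
  fixes z :: "'n \<Rightarrow> 'k::field ^ 'n::{finite,linorder}"
  assumes z: "coordinate_basis C z Z" and C: "card C = Suc d" and d: "1 \<le> d"
  shows "\<exists>f. coordinate_basis ((\<lambda>c. C - {c}) ` C) f (contraction_space d Z)"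
proof -
  note Z = coordinate_basisD[OF z]
  have "\<exists>Q \<in> contraction_space d Z. \<forall>c'\<in>C. Q $ (C - {c'}) = of_bool (c = c')" if c: "c \<in> C" for c
  proof -
    let ?D = "C - {c}"
    let ?Y = "vec.span (z ` ?D)"
    have YZ: "?Y \<subseteq> Z"
      by (intro vec.span_minimal Z(1)) (auto intro: Z(2))
    have Yc: "v $ c = 0" if "v \<in> ?Y" for v
    proof -
      have "?Y \<subseteq> {v. v $ c = 0}"
        using c by (intro vec.span_minimal vec.subspaceI) (auto simp: Z(3))
      thus ?thesis using that by auto
    qed
    have card_D: "card ?D = d" using C c by simp
    obtain Q where Q: "pluecker_coords d ?Y Q" "Q $ ?D = 1"
      using coordinate_basis_pluecker_coords[OF coordinate_basis_span_image[of ?D z]] Z(3) card_D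
      by auto
    have "Q $ (C - {c'}) = 0" if "c' \<in> C" "c' \<noteq> c" for c'
    proof -
      let ?A = "?D - {c'}"
      have "Suc (card ?A) = d" using that card_D d by simp
      from Yc[OF pluecker_coords_contraction[OF Q(1) this]]
      have "Q $ insert c ?A = 0" by (simp add: contraction_def)
      moreover have "insert c ?A = C - {c'}" using that c by auto
      ultimately show ?thesis by simp
    qed
    thus ?thesis
      using Q pluecker_coords_in_contraction_space[OF Q(1) YZ d] by (intro bexI[of _ Q]) auto
  qed
  hence "\<exists>Q. \<forall>c\<in>C. Q c \<in> contraction_space d Z \<and>
      (\<forall>c'\<in>C. Q c $ (C - {c'}) = of_bool (c = c'))"
    by (intro bchoice) blast
  then obtain Q where Q: "\<And>c. c \<in> C \<Longrightarrow> Q c \<in> contraction_space d Z"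
    "\<And>c c'. c \<in> C \<Longrightarrow> c' \<in> C \<Longrightarrow> Q c $ (C - {c'}) = of_bool (c = c')"
    by blast
  have inj: "inj_on (\<lambda>c. C - {c}) C" by (auto simp: inj_on_def)
  let ?f = "\<lambda>J. Q (the_inv_into C (\<lambda>c. C - {c}) J)"
  have f: "?f (C - {c}) = Q c" if "c \<in> C" for c
    using the_inv_into_f_f[OF inj that] by simp
  have "coordinate_basis ((\<lambda>c. C - {c}) ` C) ?f (contraction_space d Z)"
    unfolding coordinate_basis_def
  proof (intro conjI ballI impI)
    show "vec.subspace (contraction_space d Z)"
      by (rule subspace_contraction_space[OF Z(1)])
    fix J assume "J \<in> (\<lambda>c. C - {c}) ` C"
    then obtain c where c: "c \<in> C" "J = C - {c}" by auto
    thus "?f J \<in> contraction_space d Z" using Q(1) f by simp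
    fix J' assume "J' \<in> (\<lambda>c. C - {c}) ` C"
    then obtain c' where c': "c' \<in> C" "J' = C - {c'}" by auto
    have "J = J' \<longleftrightarrow> c = c'" using c c' by auto
    thus "?f J $ J' = of_bool (J = J')" using c c' f Q(2) by simp
  next
    fix P assume "P \<in> contraction_space d Z" "\<forall>J\<in>(\<lambda>c. C - {c}) ` C. P $ J = 0"
    thus "P = 0" by (intro contraction_space_eq_0[OF z C d]) auto
  qed
  thus ?thesis by blast
qed

lemma dim_contraction_space:
  fixes z :: "'n \<Rightarrow> 'k::field ^ 'n::{finite,linorder}"
  assumes "coordinate_basis C z Z" "card C = Suc d" "1 \<le> d"
  shows "vec.dim (contraction_space d Z) = Suc d"
proof -
  have "inj_on (\<lambda>c. C - {c}) C" by (auto simp: inj_on_def)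
  moreover obtain f where "coordinate_basis ((\<lambda>c. C - {c}) ` C) f (contraction_space d Z)"
    using contraction_space_coordinate_basis[OF assms] by blast
  ultimately show ?thesis
    using coordinate_basis_independent(4)[of _ f "contraction_space d Z"] assms(2)
    by (simp add: card_image)
qed

section \<open>Incidence relations as conditions on contractions\<close>

text \<open>
  The sign of an incidence relation is the product of the sign of the contraction by \<open>A\<close> and the
  sign of the incidence form of \<open>B\<close>, and leaving out \<open>i \<in> S\<close> is the same as projecting first.
\<close>

lemma incidence_eq_incidence_form:
  "incidence S q A B P = incidence_form q B (pr S (contraction P A))"
proof -
  have "incidence_form q B (pr S (contraction P A)) =
      (\<Sum>i\<in>B. if i \<in> A \<union> S then 0
        else (-1) ^ (card ({..i} \<inter> A) + card ({..i} \<inter> B)) * q $ (B - {i}) * P $ insert i A)"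
    unfolding incidence_form_def
    by (rule sum.cong) (auto simp: pr_def contraction_def power_add)
  also have "\<dots> = incidence S q A B P"
    unfolding incidence_def by (rule sum.mono_neutral_cong_right) auto
  finally show ?thesis ..
qed

lemma U_matrix_mult_nth:
  "(U_matrix d S q *v P) $ (A, B) =
     (if card A = d - 1 \<and> card B = d + 2 then incidence S q A B P else 0)"
proof -
  let ?I = "B - (A \<union> S)"
  let ?s = "\<lambda>i. (-1) ^ (card ({..i} \<inter> A) + card ({..i} \<inter> B)) * q $ (B - {i})"
  have "(\<Sum>J\<in>UNIV. (\<Sum>i | i \<in> ?I \<and> J = insert i A. ?s i) * P $ J) =
      (\<Sum>J\<in>UNIV. \<Sum>i\<in>?I. if J = insert i A then ?s i * P $ J else 0)"
  proof (rule sum.cong[OF refl])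
    fix J
    have "(\<Sum>i\<in>?I. if J = insert i A then ?s i * P $ J else 0) =
        (\<Sum>i\<in>{i \<in> ?I. J = insert i A}. ?s i * P $ J)"
      by (rule sum.inter_filter[symmetric]) simp
    thus "(\<Sum>i | i \<in> ?I \<and> J = insert i A. ?s i) * P $ J =
        (\<Sum>i\<in>?I. if J = insert i A then ?s i * P $ J else 0)"
      by (simp only: sum_distrib_right)
  qed
  also have "\<dots> = (\<Sum>i\<in>?I. \<Sum>J\<in>UNIV. if J = insert i A then ?s i * P $ J else 0)"
    by (rule sum.swap)
  also have "\<dots> = incidence S q A B P"
    by (simp add: incidence_def)
  finally show ?thesis
    by (cases "card A = d - 1 \<and> card B = d + 2")
      (auto simp: U_matrix_def matrix_vector_mult_def)
qed

lemma U_kernel_eq_incidence: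
  "U_kernel d S q = {P \<in> pluecker_space d.
     \<forall>A B. card A = d - 1 \<longrightarrow> card B = d + 2 \<longrightarrow> incidence S q A B P = 0}"
  by (auto simp: U_kernel_def Finite_Cartesian_Product.vec_eq_iff U_matrix_mult_nth)

lemma incidence_locus_eq_projectivization:
  "incidence_locus d S q = projectivization (U_kernel d S q)"
  by (auto simp: incidence_locus_def projectivization_def U_kernel_eq_incidence)

text \<open>
  Here the incidence forms do their work: vanishing of all of them on \<open>pr S (contraction P A)\<close>
  means that this vector lies in \<open>X\<close>.
\<close>

lemma U_kernel_eq_contraction_space:
  assumes "pluecker_coords (d + 1) X q" "card C = d + 1" "q $ C \<noteq> 0"
  shows "U_kernel d S q = contraction_space d {v. pr S v \<in> X}"
proof -
  have "pr S (contraction P A) \<in> X \<longleftrightarrow>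
      (\<forall>B. card B = d + 2 \<longrightarrow> incidence S q A B P = 0)" for P A
    using incidence_forms_cut_out[of C X q] assms by (simp add: incidence_eq_incidence_form)
  thus ?thesis
    by (auto simp: U_kernel_eq_incidence contraction_space_def)
qed

lemma projectivization_contraction_space:
  assumes z: "coordinate_basis C z Z" and C: "card C = Suc d" and d: "1 \<le> d"
  shows "projectivization (contraction_space d Z) =
    {vec.span {P} | P Y. Y \<subseteq> Z \<and> pluecker_coords d Y P}" (is "?L = ?R")
proof
  show "?R \<subseteq> ?L"
    using pluecker_coords_in_contraction_space pluecker_coords_nonzero d
    unfolding projectivization_def by blast
  show "?L \<subseteq> ?R"
  proof
    fix l assume "l \<in> ?L"
    then obtain P where P: "P \<in> contraction_space d Z" "P \<noteq> 0" "l = vec.span {P}"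
      by (auto simp: projectivization_def)
    obtain Y a where Y: "a \<noteq> 0" "Y \<subseteq> Z" "pluecker_coords d Y (a *s P)"
      using contraction_space_decomposable[OF z C d P(1,2)] by blast
    have "inverse a *s (a *s P) \<in> vec.span {a *s P}"
      by (intro vec.span_scale vec.span_base) simp
    hence "P \<in> vec.span {a *s P}"
      using Y(1) by simp
    moreover have "a *s P \<in> vec.span {P}"
      by (intro vec.span_scale vec.span_base) simp
    ultimately have "l = vec.span {a *s P}"
      unfolding P(3) by (simp add: vec.span_eq)
    with Y show "l \<in> ?R" by blast
  qed
qed

section \<open>The variety of subspaces that project into a given space\<close>

theorem corollary16:
  fixes X :: "('k::alg_closed_field ^ 'n::{finite,linorder}) set"
    and q :: "'k ^ 'n set"
    and S :: "'n set"
    and d :: nat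
  assumes "1 \<le> d" and "d \<le> CARD('n) - 1"
    and "X \<in> grassmannian (d + 1)"
    and "pluecker_coords (d + 1) X q"
    and "\<exists>C. card C = d + 1 \<and> S \<subseteq> C \<and> q $ C \<noteq> 0"
  shows "(\<exists>m\<le>d. linear_projective_variety (pluecker_space d) m (L_variety d S X)) \<and>
    L_variety d S X = incidence_locus d S q \<and>
    L_variety d S X = projectivization (U_kernel d S q)"
proof -
  obtain C where C: "card C = d + 1" "S \<subseteq> C" "q $ C \<noteq> 0"
    using assms(5) by blast
  let ?Z = "{v. pr S v \<in> X}"
  let ?W = "contraction_space d ?Z"
  have "coordinate_basis C (contraction_frame q C) X"
    using assms(4) C by (intro contraction_frame_coordinate_basis) simp_all
  from coordinate_basis_pr_vimage[OF this C(2)]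
  obtain z where z: "coordinate_basis C z ?Z" by blast
  have cardC: "card C = Suc d" using C by simp
  have "L_variety d S X = {vec.span {P} | P Y. Y \<subseteq> ?Z \<and> pluecker_coords d Y P}"
    unfolding L_variety_def using pluecker_coords_imp_grassmannian by blast
  hence L: "L_variety d S X = projectivization ?W"
    using projectivization_contraction_space[OF z cardC assms(1)] by simp
  have "vec.subspace ?W" "?W \<subseteq> pluecker_space d" "vec.dim ?W = d + 1"
    using subspace_contraction_space[OF coordinate_basisD(1)[OF z]]
      dim_contraction_space[OF z cardC assms(1)]
    by (auto simp: contraction_space_def)
  hence "linear_projective_variety (pluecker_space d) d (L_variety d S X)"
    unfolding linear_projective_variety_def using L by blast
  moreover have "U_kernel d S q = ?W"
    using assms(4) C by (intro U_kernel_eq_contraction_space)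
  ultimately show ?thesis
    using L incidence_locus_eq_projectivization[of d S q] by auto
qed

end
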